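(* Let $\mathcal{F}$ be a $\sigma$-algebra on a set $\Omega$, let $\mathcal{L}^{\infty}$ be the space of bounded $\mathcal{F}$-measurable functions $f:\Omega\to\mathbb{R}$, let $\mathcal{H}\subset\mathcal{L}^{\infty}$ be a set with $\mathbf{1}_{\Omega}\in\mathcal{H}$, and let $\pi:\mathcal{H}\to\mathbb{R}$ be a function (a prevision). The following conditions are equivalent: \begin{enumerate} \item $\pi$ is coherent; \item there exists a finitely additive probability measure $\mathfrak{p}\in\mathcal{P}_f$ on $(\Omega,\mathcal{F})$ such that $E_{\mathfrak{p}}[h]=\pi(h)$ for all $h\in\mathcal{H}$. \end{enumerate} In addition, if $\pi$ is coherent but there exist $n\in\mathbb{N}$, $f_1,\dots,f_n\in\mathcal{H}$ and $(\beta_1,\dots,\beta_n)\in\mathbb{R}^n$ such that $$\sum_{i=1}^n\beta_i(\pi(f_i)-f_i(\omega))>0\quad\text{for all }\omega\in\Omega,$$ then any $\mathfrak{p}\in\mathcal{P}_f$ with $E_{\mathfrak{p}}[h]=\pi(h)$ for all $h\in\mathcal{H}$ cannot be countably additive.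
   Context: Coherence: a function $\pi:\mathcal{H}\to\mathbb{R}$ is coherent if for every $n\in\mathbb{N}$, $f_1,\dots,f_n\in\mathcal{H}$ and $\beta_1,\dots,\beta_n\in\mathbb{R}$ one has $\inf_{\omega\in\Omega}\sum_{i=1}^n\beta_i[\pi(f_i)-f_i(\omega)]\le 0$. $\mathcal{P}_f$ is the set of finitely additive probability measures, i.e. set functions $\mathfrak{p}:\mathcal{F}\to\mathbb{R}$ with $\mathfrak{p}(A)\ge 0$ for every $A\in\mathcal{F}$, $\mathfrak{p}(\Omega)=1$, and $\mathfrak{p}(A\cup B)=\mathfrak{p}(A)+\mathfrak{p}(B)$ for all disjoint $A,B\in\mathcal{F}$. For $\mathfrak{p}\in\mathcal{P}_f$ and $f\in\mathcal{L}^{\infty}$, $E_{\mathfrak{p}}[f]=\int_{\Omega}f\,d\mathfrak{p}$ is the integral with respect to a finitely additive measure: for an $\mathcal{F}$-measurable simple function $g=\sum_{i=1}^N\alpha_i\mathbf{1}_{A_i}$ (with $\{A_i\}$ an $\mathcal{F}$-measurable partition of $\Omega$) it equals $\sum_{i=1}^N\alpha_i\mathfrak{p}(A_i)$, and in general $\int_{\Omega}f\,d\mathfrak{p}=\sup\{\int_{\Omega}g\,d\mathfrak{p}\mid g\text{ simple},\ g\le f\}$. Here $\mathbf{1}_A$ denotes the indicator function of $A$, so $\mathbf{1}_\Omega$ is the constant function $1$. *)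

theory Defs
  imports "HOL-Analysis.Analysis"
begin

text \<open>
  A function on the set \<open>\<Omega>\<close> is represented by its unique extensional total function, so that
  two elements of \<open>Linfty \<Omega> F\<close> are equal iff they agree on \<open>\<Omega>\<close>.
  A measurable space \<open>(\<Omega>, F)\<close> is passed to the library as \<open>sigma \<Omega> F\<close>; only the space
  and the measurable sets of this object are used.
\<close>

definition Linfty :: "'a set \<Rightarrow> 'a set set \<Rightarrow> ('a \<Rightarrow> real) set" where
  "Linfty \<Omega> F =
    {f \<in> extensional \<Omega>. f \<in> borel_measurable (sigma \<Omega> F) \<and> bounded (f ` \<Omega>)}"

text \<open>
  The infimum is taken in \<^typ>\<open>ereal\<close>, where it is meaningful for every set, including the
  empty one.
\<close>

definition coherent :: "'a set \<Rightarrow> ('a \<Rightarrow> real) set \<Rightarrow> (('a \<Rightarrow> real) \<Rightarrow> real) \<Rightarrow> bool" where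
  "coherent \<Omega> H \<pi> \<longleftrightarrow>
    (\<forall>(n::nat) (f :: nat \<Rightarrow> 'a \<Rightarrow> real) (\<beta> :: nat \<Rightarrow> real).
      (\<forall>i\<in>{1..n}. f i \<in> H) \<longrightarrow>
      (INF \<omega>\<in>\<Omega>. ereal (\<Sum>i=1..n. \<beta> i * (\<pi> (f i) - f i \<omega>))) \<le> 0)"

text \<open>The values of a set function outside \<open>F\<close> are irrelevant.\<close>

definition fin_add_prob :: "'a set \<Rightarrow> 'a set set \<Rightarrow> ('a set \<Rightarrow> real) set" where
  "fin_add_prob \<Omega> F = {p. (\<forall>A\<in>F. 0 \<le> p A) \<and> p \<Omega> = 1 \<and> additive F p}"

text \<open>
  The integral of a simple function, via its canonical partition into level sets; lemma
  \<open>fa_simple_integral_partition\<close> below shows that every measurable partition yields the same value.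
\<close>

definition fa_simple_integral :: "'a set \<Rightarrow> ('a set \<Rightarrow> real) \<Rightarrow> ('a \<Rightarrow> real) \<Rightarrow> real" where
  "fa_simple_integral \<Omega> p g = (\<Sum>x\<in>g ` \<Omega>. x * p (g -` {x} \<inter> \<Omega>))"

definition fa_integral :: "'a set \<Rightarrow> 'a set set \<Rightarrow> ('a set \<Rightarrow> real) \<Rightarrow> ('a \<Rightarrow> real) \<Rightarrow> real" where
  "fa_integral \<Omega> F p f =
    Sup {fa_simple_integral \<Omega> p g | g.
          simple_function (sigma \<Omega> F) g \<and> (\<forall>\<omega>\<in>\<Omega>. g \<omega> \<le> f \<omega>)}"

lemma fin_add_prob_UN:
  assumes "sigma_algebra \<Omega> F" and p: "p \<in> fin_add_prob \<Omega> F"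
    and "finite I" and "\<And>i. i \<in> I \<Longrightarrow> A i \<in> F" and "disjoint_family_on A I"
  shows "p (\<Union>i\<in>I. A i) = (\<Sum>i\<in>I. p (A i))"
  using assms(3-5)
proof (induction I rule: finite_induct)
  interpret sigma_algebra \<Omega> F by fact
  case empty
  have "p ({} \<union> {}) = p {} + p {}"
    using p unfolding fin_add_prob_def additive_def by blast
  then show ?case by simp
next
  interpret sigma_algebra \<Omega> F by fact
  case (insert j I)
  have "(\<Union>i\<in>I. A i) \<in> F"
    using insert.hyps insert.prems by auto
  moreover have "A j \<inter> (\<Union>i\<in>I. A i) = {}"
    using insert.hyps insert.prems(2) by (auto simp: disjoint_family_on_def)
  ultimately have "p (A j \<union> (\<Union>i\<in>I. A i)) = p (A j) + p (\<Union>i\<in>I. A i)"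
    using p insert.prems(1) unfolding fin_add_prob_def additive_def by auto
  moreover have "p (\<Union>i\<in>I. A i) = (\<Sum>i\<in>I. p (A i))"
    using insert by (auto simp: disjoint_family_on_def)
  ultimately show ?case
    using insert.hyps by simp
qed

lemma fa_simple_integral_partition:
  fixes \<alpha> :: "'i \<Rightarrow> real"
  assumes "sigma_algebra \<Omega> F" and p: "p \<in> fin_add_prob \<Omega> F"
    and fin: "finite I" and A: "\<And>i. i \<in> I \<Longrightarrow> A i \<in> F" and disj: "disjoint_family_on A I"
    and un: "(\<Union>i\<in>I. A i) = \<Omega>"
    and g: "\<And>\<omega>. \<omega> \<in> \<Omega> \<Longrightarrow> g \<omega> = (\<Sum>i\<in>I. \<alpha> i * indicator (A i) \<omega>)"
  shows "fa_simple_integral \<Omega> p g = (\<Sum>i\<in>I. \<alpha> i * p (A i))"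
proof -
  have val: "g \<omega> = \<alpha> i" if "i \<in> I" "\<omega> \<in> A i" for i \<omega>
  proof -
    have "g \<omega> = (\<Sum>j\<in>I. if j = i then \<alpha> j else 0)"
    proof -
      have "\<omega> \<notin> A j" if "j \<in> I" "j \<noteq> i" for j
        using disj \<open>i \<in> I\<close> \<open>\<omega> \<in> A i\<close> that unfolding disjoint_family_on_def by blast
      moreover have "\<omega> \<in> \<Omega>" using that un by blast
      ultimately show ?thesis
        using that by (subst g) (auto intro!: sum.cong)
    qed
    then show ?thesis using that fin by simp
  qed
  have p0: "p {} = 0"
    using fin_add_prob_UN[OF assms(1,2), of "{}" A] by (simp add: disjoint_family_on_def)
  have img: "g ` \<Omega> \<subseteq> \<alpha> ` I"
    using un val by auto
  have level: "p (g -` {x} \<inter> \<Omega>) = (\<Sum>i\<in>{i\<in>I. \<alpha> i = x}. p (A i))" for x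
  proof -
    have "g -` {x} \<inter> \<Omega> = (\<Union>i\<in>{i\<in>I. \<alpha> i = x}. A i)"
      using un val by auto
    then show ?thesis
      using fin_add_prob_UN[OF assms(1,2), of "{i\<in>I. \<alpha> i = x}" A] fin A disj
      by (auto simp: disjoint_family_on_def)
  qed
  have "fa_simple_integral \<Omega> p g = (\<Sum>x\<in>\<alpha> ` I. x * p (g -` {x} \<inter> \<Omega>))"
    unfolding fa_simple_integral_def
  proof (rule sum.mono_neutral_left)
    show "\<forall>x\<in>\<alpha> ` I - g ` \<Omega>. x * p (g -` {x} \<inter> \<Omega>) = 0"
    proof
      fix x assume "x \<in> \<alpha> ` I - g ` \<Omega>"
      then have "g -` {x} \<inter> \<Omega> = {}" by blast
      then show "x * p (g -` {x} \<inter> \<Omega>) = 0" using p0 by simp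
    qed
  qed (use fin img in auto)
  also have "\<dots> = (\<Sum>x\<in>\<alpha> ` I. \<Sum>i\<in>{i\<in>I. \<alpha> i = x}. \<alpha> i * p (A i))"
    unfolding level sum_distrib_left by (intro sum.cong) auto
  also have "\<dots> = (\<Sum>i\<in>I. \<alpha> i * p (A i))"
    using fin by (intro sum.group) auto
  finally show ?thesis .
qed

end

theory Submission
  imports Defs
begin

text \<open>
  A finitely additive integral is coherent: on simple functions this is a finite weighted average
  over the common refinement of the level sets, and bounded measurable functions are uniform limits
  of simple ones. Conversely, coherence says that the space of the gambles
  \<open>\<Sum> \<beta> (\<pi> f - f)\<close> contains no function that is uniformly positive. A maximal space with this
  property contains \<open>c - f\<close> for exactly one constant \<open>c\<close>, for each bounded \<open>f\<close> (the
  Hahn-Banach step), and \<open>f \<mapsto> c\<close> is the expectation sought. If \<open>p\<close> is countably additive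
  and a gamble \<open>u\<close> is positive everywhere, then some \<open>{u > 1/k}\<close> has positive
  measure, which makes the expectation of \<open>u\<close> positive, whereas it is \<open>0\<close>.
\<close>

subsection \<open>The finitely additive integral\<close>

text \<open>On each cell of the common refinement the gamble is constant. Averaging the bound over
  the cells with the weights given by \<open>p\<close> leaves \<open>d\<close> on the left and, term
  by term, an integral minus itself on the right. A real lower bound \<open>d\<close> takes the
  place of the infimum. Monotonicity of the integral and coherence of \<open>fa_integral\<close> are
  both drawn from this inequality.\<close>

lemma fa_simple_integral_coherent:
  fixes g :: "'i \<Rightarrow> 'a \<Rightarrow> real"
  assumes sa: "sigma_algebra \<Omega> F" and p: "p \<in> fin_add_prob \<Omega> F" and J: "finite J"
    and g: "\<And>i. i \<in> J \<Longrightarrow> simple_function (sigma \<Omega> F) (g i)"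
    and d: "\<And>\<omega>. \<omega> \<in> \<Omega> \<Longrightarrow> d \<le> (\<Sum>i\<in>J. \<beta> i * (fa_simple_integral \<Omega> p (g i) - g i \<omega>))"
  shows "d \<le> 0"
proof -
  interpret sigma_algebra \<Omega> F by fact
  \<comment> \<open>The fibres of this joint value map are the cells of the common refinement.
    Restricting to \<open>J\<close> places its values in a finite \<open>PiE\<close>, so there are
    finitely many cells.\<close>
  define v where "v = (\<lambda>\<omega>. restrict (\<lambda>i. g i \<omega>) J)"
  define X where "X = v ` \<Omega>"
  define A where "A = (\<lambda>x. v -` {x} \<inter> \<Omega>)"
  let ?I = "\<lambda>i. fa_simple_integral \<Omega> p (g i)"
  have "X \<subseteq> PiE J (\<lambda>i. g i ` \<Omega>)"
    by (auto simp: X_def v_def)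
  moreover have "finite (g i ` \<Omega>)" if "i \<in> J" for i
    using g[OF that] by (simp add: simple_function_def space_measure_of_conv)
  ultimately have X: "finite X"
    using J by (meson finite_PiE finite_subset)
  have A: "A x \<in> F" if "x \<in> X" for x
  proof -
    have "A x = {\<omega>\<in>\<Omega>. \<forall>i\<in>J. g i \<omega> = x i}"
    proof -
      from that obtain \<omega>' where "x = restrict (\<lambda>i. g i \<omega>') J" by (auto simp: X_def v_def)
      then have "v \<omega> = x \<longleftrightarrow> (\<forall>i\<in>J. g i \<omega> = x i)" for \<omega>
        by (auto simp: v_def restrict_def fun_eq_iff)
      then show ?thesis by (auto simp: A_def)
    qed
    moreover have "{\<omega>\<in>\<Omega>. g i \<omega> = x i} \<in> F" if "i \<in> J" for i
    proof -
      have "{\<omega>\<in>\<Omega>. g i \<omega> = x i} = g i -` {x i} \<inter> space (sigma \<Omega> F)"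
        by (auto simp: space_measure_of_conv)
      also have "\<dots> \<in> sets (sigma \<Omega> F)"
        by (rule simple_functionD[OF g[OF that]])
      finally show ?thesis by simp
    qed
    ultimately show ?thesis
      using J by (simp add: sets_Collect_finite_All)
  qed
  have disj: "disjoint_family_on A X"
    by (auto simp: disjoint_family_on_def A_def)
  have un: "(\<Union>x\<in>X. A x) = \<Omega>"
    by (auto simp: A_def X_def)
  have p1: "(\<Sum>x\<in>X. p (A x)) = 1"
    using fin_add_prob_UN[OF sa p X A disj] un p by (simp add: fin_add_prob_def)
  have I: "?I i = (\<Sum>x\<in>X. x i * p (A x))" if "i \<in> J" for i
  proof (rule fa_simple_integral_partition[OF sa p X A disj un])
    fix \<omega> assume \<omega>: "\<omega> \<in> \<Omega>"
    have "(\<Sum>x\<in>X. x i * indicator (A x) \<omega>) = (\<Sum>x\<in>X. if x = v \<omega> then x i else 0)"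
      using \<omega> by (intro sum.cong) (auto simp: A_def)
    then show "g i \<omega> = (\<Sum>x\<in>X. x i * indicator (A x) \<omega>)"
      using X \<omega> that by (simp add: X_def v_def)
  qed
  have "d = (\<Sum>x\<in>X. p (A x) * d)"
    using p1 by (simp add: sum_distrib_right[symmetric])
  also have "\<dots> \<le> (\<Sum>x\<in>X. p (A x) * (\<Sum>i\<in>J. \<beta> i * (?I i - x i)))"
  proof (intro sum_mono mult_left_mono)
    fix x assume "x \<in> X"
    then obtain \<omega> where \<omega>: "\<omega> \<in> \<Omega>" "x = v \<omega>" by (auto simp: X_def)
    have "(\<Sum>i\<in>J. \<beta> i * (?I i - x i)) = (\<Sum>i\<in>J. \<beta> i * (?I i - g i \<omega>))"
      by (intro sum.cong) (auto simp: \<omega> v_def)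
    then show "d \<le> (\<Sum>i\<in>J. \<beta> i * (?I i - x i))"
      using d \<omega> by simp
    show "0 \<le> p (A x)"
      using p A[OF \<open>x \<in> X\<close>] by (simp add: fin_add_prob_def)
  qed
  \<comment> \<open>Exchanging the sums isolates each \<open>i\<close>; its average vanishes because
    the weights sum to 1 and the average of \<open>x i\<close> is the integral of
    \<open>g i\<close>.\<close>
  also have "\<dots> = (\<Sum>i\<in>J. \<beta> i * (\<Sum>x\<in>X. p (A x) * (?I i - x i)))"
    unfolding sum_distrib_left by (subst sum.swap) (simp add: mult.left_commute)
  also have "\<dots> = 0"
  proof (intro sum.neutral ballI)
    fix i assume "i \<in> J"
    have "(\<Sum>x\<in>X. p (A x) * (?I i - x i)) = ?I i * (\<Sum>x\<in>X. p (A x)) - (\<Sum>x\<in>X. x i * p (A x))"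
      unfolding sum_distrib_left sum_subtractf[symmetric] by (simp add: algebra_simps)
    then show "\<beta> i * (\<Sum>x\<in>X. p (A x) * (?I i - x i)) = 0"
      using I[OF \<open>i \<in> J\<close>] p1 by simp
  qed
  finally show ?thesis .
qed

text \<open>Coherence applied to the pair with coefficient 1 for \<open>h\<close> and -1 for
  \<open>g\<close>: the resulting gamble is at least the difference of the integrals minus
  \<delta>.\<close>

lemma fa_simple_integral_le_add:
  assumes sa: "sigma_algebra \<Omega> F" and p: "p \<in> fin_add_prob \<Omega> F"
    and g: "simple_function (sigma \<Omega> F) g" and h: "simple_function (sigma \<Omega> F) h"
    and le: "\<And>\<omega>. \<omega> \<in> \<Omega> \<Longrightarrow> h \<omega> \<le> g \<omega> + \<delta>"
  shows "fa_simple_integral \<Omega> p h \<le> fa_simple_integral \<Omega> p g + \<delta>"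
proof -
  have "fa_simple_integral \<Omega> p h - fa_simple_integral \<Omega> p g - \<delta> \<le> 0"
  proof (rule fa_simple_integral_coherent[OF sa p, where J = UNIV and
        g = "\<lambda>b. if b then h else g" and \<beta> = "\<lambda>b. if b then 1 else - 1"])
    fix \<omega> assume "\<omega> \<in> \<Omega>"
    from le[OF this] show "fa_simple_integral \<Omega> p h - fa_simple_integral \<Omega> p g - \<delta> \<le>
        (\<Sum>b\<in>UNIV. (if b then 1 else - 1) *
          (fa_simple_integral \<Omega> p (if b then h else g) - (if b then h else g) \<omega>))"
      by (simp add: UNIV_bool)
  qed (use g h in auto)
  then show ?thesis by simp
qed

text \<open>The function \<open>g\<close> itself competes in the supremum, and every other
  competitor lies below \<open>g + \<delta>\<close>. So the supremum can be handled through any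
  single simple minorant that is uniformly close to \<open>f\<close>.\<close>

lemma fa_integral_between:
  assumes sa: "sigma_algebra \<Omega> F" and p: "p \<in> fin_add_prob \<Omega> F"
    and g: "simple_function (sigma \<Omega> F) g"
    and le: "\<And>\<omega>. \<omega> \<in> \<Omega> \<Longrightarrow> g \<omega> \<le> f \<omega>" "\<And>\<omega>. \<omega> \<in> \<Omega> \<Longrightarrow> f \<omega> \<le> g \<omega> + \<delta>"
  shows "fa_simple_integral \<Omega> p g \<le> fa_integral \<Omega> F p f"
    and "fa_integral \<Omega> F p f \<le> fa_simple_integral \<Omega> p g + \<delta>"
proof -
  let ?S = "{fa_simple_integral \<Omega> p g | g.
          simple_function (sigma \<Omega> F) g \<and> (\<forall>\<omega>\<in>\<Omega>. g \<omega> \<le> f \<omega>)}"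
  have in_S: "fa_simple_integral \<Omega> p g \<in> ?S"
    using g le by blast
  have bound: "x \<le> fa_simple_integral \<Omega> p g + \<delta>" if "x \<in> ?S" for x
  proof -
    obtain h where h: "simple_function (sigma \<Omega> F) h" "\<forall>\<omega>\<in>\<Omega>. h \<omega> \<le> f \<omega>"
      and x: "x = fa_simple_integral \<Omega> p h"
      using \<open>x \<in> ?S\<close> by blast
    have "h \<omega> \<le> g \<omega> + \<delta>" if "\<omega> \<in> \<Omega>" for \<omega>
      using h(2) le(2)[OF that] that by force
    then show ?thesis
      unfolding x by (rule fa_simple_integral_le_add[OF sa p g h(1)])
  qed
  show "fa_simple_integral \<Omega> p g \<le> fa_integral \<Omega> F p f"
    unfolding fa_integral_def using in_S bound by (intro cSup_upper) (auto intro!: bdd_aboveI)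
  show "fa_integral \<Omega> F p f \<le> fa_simple_integral \<Omega> p g + \<delta>"
    unfolding fa_integral_def using in_S bound by (intro cSup_least) auto
qed

section \<open>Passage from simple to bounded measurable functions\<close>

lemma bounded_measurable_approx_simple:
  fixes f :: "'a \<Rightarrow> real"
  assumes f: "f \<in> borel_measurable M" and "bounded (f ` space M)" and \<delta>: "0 < \<delta>"
  obtains g where "simple_function M g"
    "\<And>\<omega>. g \<omega> \<le> f \<omega>" "\<And>\<omega>. f \<omega> \<le> g \<omega> + \<delta>"
proof
  \<comment> \<open>Rounding down to the grid of multiples of \<delta>; boundedness leaves finitely
    many grid values on the space.\<close>
  let ?g = "\<lambda>\<omega>. \<delta> * real_of_int \<lfloor>f \<omega> / \<delta>\<rfloor>"
  from assms(2) obtain B where B: "\<And>\<omega>. \<omega> \<in> space M \<Longrightarrow> \<bar>f \<omega>\<bar> \<le> B"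
    by (auto simp: bounded_iff)
  have "?g ` space M \<subseteq> (\<lambda>k. \<delta> * real_of_int k) ` {\<lfloor>- B / \<delta>\<rfloor>..\<lfloor>B / \<delta>\<rfloor>}"
  proof
    fix y assume "y \<in> ?g ` space M"
    then obtain \<omega> where \<omega>: "\<omega> \<in> space M" "y = ?g \<omega>" by blast
    have "- B / \<delta> \<le> f \<omega> / \<delta>" "f \<omega> / \<delta> \<le> B / \<delta>"
      using B[OF \<omega>(1)] \<delta> by (intro divide_right_mono; simp)+
    then show "y \<in> (\<lambda>k. \<delta> * real_of_int k) ` {\<lfloor>- B / \<delta>\<rfloor>..\<lfloor>B / \<delta>\<rfloor>}"
      unfolding \<omega>(2) by (intro imageI) (auto intro: floor_mono)
  qed
  then have "finite (?g ` space M)"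
    by (rule finite_subset) simp
  moreover have "?g \<in> borel_measurable M"
    using f by measurable
  ultimately show "simple_function M ?g"
    by (intro simple_function_borel_measurable)
  show "?g \<omega> \<le> f \<omega>" for \<omega>
    using mult_left_mono[OF of_int_floor_le[of "f \<omega> / \<delta>"], of \<delta>] \<delta> by simp
  show "f \<omega> \<le> ?g \<omega> + \<delta>" for \<omega>
  proof -
    have "f \<omega> / \<delta> \<le> real_of_int \<lfloor>f \<omega> / \<delta>\<rfloor> + 1" by linarith
    from mult_left_mono[OF this, of \<delta>] show ?thesis
      using \<delta> by (simp add: algebra_simps)
  qed
qed

text \<open>Replacing each \<open>f i\<close> by a simple minorant within \<delta> changes the
  gamble by at most \<delta> times the sum of the absolute coefficients, and this error can be made
  arbitrarily small.\<close>

lemma fa_integral_coherent: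
  fixes f :: "'i \<Rightarrow> 'a \<Rightarrow> real"
  assumes sa: "sigma_algebra \<Omega> F" and p: "p \<in> fin_add_prob \<Omega> F" and J: "finite J"
    and f: "\<And>i. i \<in> J \<Longrightarrow> f i \<in> borel_measurable (sigma \<Omega> F)"
    and bd: "\<And>i. i \<in> J \<Longrightarrow> bounded (f i ` \<Omega>)"
    and d: "\<And>\<omega>. \<omega> \<in> \<Omega> \<Longrightarrow> d \<le> (\<Sum>i\<in>J. \<beta> i * (fa_integral \<Omega> F p (f i) - f i \<omega>))"
  shows "d \<le> 0"
proof (rule field_le_epsilon)
  fix e :: real assume e: "0 < e"
  \<comment> \<open>The summand 1 keeps \<open>B\<close> positive even if all coefficients vanish or
    \<open>J\<close> is empty.\<close>
  define B where "B = 1 + (\<Sum>i\<in>J. \<bar>\<beta> i\<bar>)"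
  have B: "B > 0" unfolding B_def by (smt (verit) abs_ge_zero sum_nonneg)
  define \<delta> where "\<delta> = e / B"
  have \<delta>: "\<delta> > 0" using e B by (simp add: \<delta>_def)
  have "\<exists>g. simple_function (sigma \<Omega> F) g \<and> (\<forall>\<omega>\<in>\<Omega>. g \<omega> \<le> f i \<omega> \<and> f i \<omega> \<le> g \<omega> + \<delta>)"
    if "i \<in> J" for i
    using bounded_measurable_approx_simple[OF f[OF that] _ \<delta>] bd[OF that]
    by (metis space_measure_of_conv)
  then obtain g where "\<forall>i\<in>J. simple_function (sigma \<Omega> F) (g i) \<and>
      (\<forall>\<omega>\<in>\<Omega>. g i \<omega> \<le> f i \<omega> \<and> f i \<omega> \<le> g i \<omega> + \<delta>)"
    by metis
  then have g: "simple_function (sigma \<Omega> F) (g i)"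
      "\<And>\<omega>. \<omega> \<in> \<Omega> \<Longrightarrow> g i \<omega> \<le> f i \<omega>" "\<And>\<omega>. \<omega> \<in> \<Omega> \<Longrightarrow> f i \<omega> \<le> g i \<omega> + \<delta>"
    if "i \<in> J" for i
    using that by auto
  let ?E = "\<lambda>i. fa_integral \<Omega> F p (f i)" and ?I = "\<lambda>i. fa_simple_integral \<Omega> p (g i)"
  have "d - e \<le> 0"
  proof (rule fa_simple_integral_coherent[OF sa p J g(1)])
    fix \<omega> assume \<omega>: "\<omega> \<in> \<Omega>"
    have "(\<Sum>i\<in>J. \<beta> i * (?E i - f i \<omega>)) - (\<Sum>i\<in>J. \<beta> i * (?I i - g i \<omega>))
        = (\<Sum>i\<in>J. \<beta> i * ((?E i - f i \<omega>) - (?I i - g i \<omega>)))"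
      by (simp add: sum_subtractf[symmetric] right_diff_distrib)
    also have "\<dots> \<le> (\<Sum>i\<in>J. \<bar>\<beta> i\<bar> * \<delta>)"
    proof (rule sum_mono)
      fix i assume i: "i \<in> J"
      have "?I i \<le> ?E i" "?E i \<le> ?I i + \<delta>"
        using fa_integral_between[OF sa p g[OF i]] by blast+
      \<comment> \<open>Both \<open>?E i - ?I i\<close> and
        \<open>f i \<omega> - g i \<omega>\<close> lie between 0 and \<delta>, so they differ by at
        most \<delta>.\<close>
      then have "\<bar>(?E i - f i \<omega>) - (?I i - g i \<omega>)\<bar> \<le> \<delta>"
        using g(2,3)[OF i \<omega>] by linarith
      then have "\<bar>\<beta> i * ((?E i - f i \<omega>) - (?I i - g i \<omega>))\<bar> \<le> \<bar>\<beta> i\<bar> * \<delta>"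
        unfolding abs_mult by (rule mult_left_mono) simp
      then show "\<beta> i * ((?E i - f i \<omega>) - (?I i - g i \<omega>)) \<le> \<bar>\<beta> i\<bar> * \<delta>"
        by linarith
    qed
    also have "\<dots> \<le> B * \<delta>"
      using \<delta> by (simp add: B_def sum_distrib_right[symmetric] distrib_right)
    also have "\<dots> = e"
      using B by (simp add: \<delta>_def)
    finally show "d - e \<le> (\<Sum>i\<in>J. \<beta> i * (?I i - g i \<omega>))"
      using d[OF \<omega>] by linarith
  qed
  then show "d \<le> 0 + e" by simp
qed

lemma fa_integral_indicator:
  assumes sa: "sigma_algebra \<Omega> F" and p: "p \<in> fin_add_prob \<Omega> F" and A: "A \<in> F"
  shows "fa_integral \<Omega> F p (indicator A) = p A"
proof -
  interpret sigma_algebra \<Omega> F by fact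
  have "fa_simple_integral \<Omega> p (indicator A) =
      (\<Sum>b\<in>UNIV. (if b then 1 else 0) * p (if b then A else \<Omega> - A))"
    using A sets_into_space[OF A]
    by (intro fa_simple_integral_partition[OF sa p])
       (auto simp: disjoint_family_on_def UNIV_bool indicator_def)
  also have "\<dots> = p A"
    by (simp add: UNIV_bool)
  finally have "fa_simple_integral \<Omega> p (indicator A) = p A" .
  moreover have "simple_function (sigma \<Omega> F) (indicator A :: 'a \<Rightarrow> real)"
    using A by (intro simple_function_indicator) auto
  \<comment> \<open>With \<delta> = 0 the two bounds meet: the integral of a simple function is its
    simple integral.\<close>
  ultimately show ?thesis
    using fa_integral_between[OF sa p, of "indicator A" "indicator A" 0] by auto
qed

subsection \<open>Coherent spaces of gambles\<close>

text \<open>The last clause excludes a sure gain bounded away from 0; a gamble that is merely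
  positive at every point is still allowed. For empty \<open>\<Omega>\<close> the clause fails, so
  gamble spaces exist only where a probability can exist.\<close>

definition gamble_space :: "'a set \<Rightarrow> ('a \<Rightarrow> real) set \<Rightarrow> bool" where
  "gamble_space \<Omega> W \<longleftrightarrow> (\<lambda>_. 0) \<in> W
     \<and> (\<forall>u\<in>W. \<forall>v\<in>W. \<forall>a b. (\<lambda>\<omega>. a * u \<omega> + b * v \<omega>) \<in> W)
     \<and> (\<forall>u\<in>W. \<forall>d. (\<forall>\<omega>\<in>\<Omega>. d \<le> u \<omega>) \<longrightarrow> d \<le> 0)"

lemma gamble_space_zero: "gamble_space \<Omega> W \<Longrightarrow> (\<lambda>_. 0) \<in> W"
  and gamble_space_comb:
    "gamble_space \<Omega> W \<Longrightarrow> u \<in> W \<Longrightarrow> v \<in> W \<Longrightarrow> (\<lambda>\<omega>. a * u \<omega> + b * v \<omega>) \<in> W"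
  and gamble_space_le_0:
    "gamble_space \<Omega> W \<Longrightarrow> u \<in> W \<Longrightarrow> (\<And>\<omega>. \<omega> \<in> \<Omega> \<Longrightarrow> d \<le> u \<omega>) \<Longrightarrow> d \<le> 0"
  by (simp_all add: gamble_space_def)

lemma gamble_space_sum:
  assumes W: "gamble_space \<Omega> W" and "finite J" "\<And>i. i \<in> J \<Longrightarrow> u i \<in> W"
  shows "(\<lambda>\<omega>. \<Sum>i\<in>J. a i * u i \<omega>) \<in> W"
  using assms(2,3)
proof (induction J rule: finite_induct)
  case empty
  then show ?case using gamble_space_zero[OF W] by simp
next
  case (insert j J)
  then have "(\<lambda>\<omega>. a j * u j \<omega> + 1 * (\<Sum>i\<in>J. a i * u i \<omega>)) \<in> W"
    by (intro gamble_space_comb[OF W]) auto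
  then show ?case using insert by simp
qed

section \<open>Maximal gamble spaces and the Hahn-Banach step\<close>

text \<open>Each defining condition concerns at most two elements, and some member of the chain
  contains both.\<close>

lemma gamble_space_Union:
  assumes "C \<noteq> {}" and chain: "\<And>V W. V \<in> C \<Longrightarrow> W \<in> C \<Longrightarrow> V \<subseteq> W \<or> W \<subseteq> V"
    and C: "\<And>W. W \<in> C \<Longrightarrow> gamble_space \<Omega> W"
  shows "gamble_space \<Omega> (\<Union>C)"
  unfolding gamble_space_def
proof (intro conjI ballI allI impI)
  show "(\<lambda>_. 0) \<in> \<Union>C"
    using assms(1) gamble_space_zero[OF C] by blast
next
  fix u v a b assume "u \<in> \<Union>C" "v \<in> \<Union>C"
  then obtain W where "W \<in> C" "u \<in> W" "v \<in> W"
    using chain by blast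
  then show "(\<lambda>\<omega>. a * u \<omega> + b * v \<omega>) \<in> \<Union>C"
    using gamble_space_comb[OF C] by blast
next
  fix u d assume "u \<in> \<Union>C" "\<forall>\<omega>\<in>\<Omega>. d \<le> u \<omega>"
  then show "d \<le> 0"
    using gamble_space_le_0[OF C] by blast
qed

text \<open>Zorn's lemma among the gamble spaces that contain \<open>W\<close>. Maximality then
  holds against all gamble spaces, because whatever contains \<open>M\<close> contains
  \<open>W\<close>.\<close>

lemma maximal_gamble_space:
  assumes W: "gamble_space \<Omega> W"
  obtains M where "gamble_space \<Omega> M" "W \<subseteq> M"
    "\<And>V. gamble_space \<Omega> V \<Longrightarrow> M \<subseteq> V \<Longrightarrow> V = M"
proof -
  have "\<exists>M\<in>{V. gamble_space \<Omega> V \<and> W \<subseteq> V}. \<forall>X\<in>{V. gamble_space \<Omega> V \<and> W \<subseteq> V}. M \<subseteq> X \<longrightarrow> X = M"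
  proof (rule subset_Zorn_nonempty)
    fix C assume C: "C \<noteq> {}" "subset.chain {V. gamble_space \<Omega> V \<and> W \<subseteq> V} C"
    then have "gamble_space \<Omega> (\<Union>C)"
      by (intro gamble_space_Union) (auto simp: subset_chain_def)
    moreover have "W \<subseteq> \<Union>C"
      using C unfolding subset_chain_def by blast
    ultimately show "\<Union>C \<in> {V. gamble_space \<Omega> V \<and> W \<subseteq> V}" by simp
  qed (use W in blast)
  then obtain M where M: "M \<in> {V. gamble_space \<Omega> V \<and> W \<subseteq> V}"
    and max: "\<forall>X\<in>{V. gamble_space \<Omega> V \<and> W \<subseteq> V}. M \<subseteq> X \<longrightarrow> X = M"
    by (rule bexE)
  show thesis
  proof (rule that)
    fix V assume "gamble_space \<Omega> V" "M \<subseteq> V"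
    then show "V = M" using M max by auto
  qed (use M in simp_all)
qed

text \<open>Adjoining \<open>c - f\<close> to \<open>M\<close>, with \<open>c\<close> the lower
  prevision of \<open>f\<close>, again yields a gamble space, which by maximality is
  \<open>M\<close> itself.\<close>

lemma maximal_gamble_space_price:
  assumes M: "gamble_space \<Omega> M" and max: "\<And>V. gamble_space \<Omega> V \<Longrightarrow> M \<subseteq> V \<Longrightarrow> V = M"
    and "bounded (f ` \<Omega>)"
  shows "\<exists>c. (\<lambda>\<omega>. c - f \<omega>) \<in> M"
proof -
  obtain B where B: "\<And>\<omega>. \<omega> \<in> \<Omega> \<Longrightarrow> \<bar>f \<omega>\<bar> \<le> B"
    using assms(3) by (auto simp: bounded_iff)
  \<comment> \<open>\<open>Sup L\<close> is the lower prevision of \<open>f\<close>; any price up to the upper one would do.\<close>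
  define L where "L = {c. \<exists>u\<in>M. \<forall>\<omega>\<in>\<Omega>. c \<le> f \<omega> + u \<omega>}"
  have "- B \<in> L"
  proof -
    have "\<forall>\<omega>\<in>\<Omega>. - B \<le> f \<omega> + 0" using B by force
    then show ?thesis
      unfolding L_def using gamble_space_zero[OF M] by (intro CollectI bexI[of _ "\<lambda>_. 0"])
  qed
  have "c \<le> B" if "c \<in> L" for c
  proof -
    from that obtain u where u: "u \<in> M" "\<forall>\<omega>\<in>\<Omega>. c \<le> f \<omega> + u \<omega>"
      by (auto simp: L_def)
    have "c - B \<le> 0"
    proof (rule gamble_space_le_0[OF M u(1)])
      fix \<omega> assume "\<omega> \<in> \<Omega>"
      then show "c - B \<le> u \<omega>" using B[of \<omega>] u(2) by force
    qed
    then show ?thesis by simp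
  qed
  then have bdd: "bdd_above L" by (rule bdd_aboveI)
  define c where "c = Sup L"
  define V where "V = {v. \<exists>u\<in>M. \<exists>t. v = (\<lambda>\<omega>. u \<omega> + t * (c - f \<omega>))}"
  have V: "(\<lambda>\<omega>. u \<omega> + t * (c - f \<omega>)) \<in> V" if "u \<in> M" for u t
    using that by (auto simp: V_def)
  have "gamble_space \<Omega> V"
    unfolding gamble_space_def
  proof (intro conjI ballI allI impI)
    show "(\<lambda>_. 0) \<in> V"
      using V[OF gamble_space_zero[OF M], of 0] by simp
  next
    fix v w a b assume "v \<in> V" "w \<in> V"
    then obtain u s u' t where u: "u \<in> M" "v = (\<lambda>\<omega>. u \<omega> + s * (c - f \<omega>))"
      and u': "u' \<in> M" "w = (\<lambda>\<omega>. u' \<omega> + t * (c - f \<omega>))"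
      unfolding V_def by blast
    have "(\<lambda>\<omega>. a * v \<omega> + b * w \<omega>) =
        (\<lambda>\<omega>. (a * u \<omega> + b * u' \<omega>) + (a * s + b * t) * (c - f \<omega>))"
      unfolding u u' by (simp add: algebra_simps)
    then show "(\<lambda>\<omega>. a * v \<omega> + b * w \<omega>) \<in> V"
      using V[OF gamble_space_comb[OF M u(1) u'(1)]] by simp
  next
    fix v d assume "v \<in> V" and d: "\<forall>\<omega>\<in>\<Omega>. d \<le> v \<omega>"
    then obtain u t where u: "u \<in> M" and v: "v = (\<lambda>\<omega>. u \<omega> + t * (c - f \<omega>))"
      unfolding V_def by blast
    show "d \<le> 0"
    proof (rule ccontr)
      assume "\<not> d \<le> 0"
      then have d0: "d > 0" by simp
      consider "t = 0" | "t > 0" | "t < 0" by linarith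
      then show False
      proof cases
        case 1
        then show False
          using gamble_space_le_0[OF M u, of d] d d0 v by auto
      next
        case 2
        \<comment> \<open>For positive \<open>t\<close> take \<open>c'\<close> in \<open>L\<close>
          within \<open>d / t\<close> of the supremum, with witness \<open>u'\<close>. Then
          \<open>u + t * u'\<close> lies in \<open>M\<close> and is at least
          \<open>d - t * (c - c')\<close>, which is positive.\<close>
        have "c - d / t < c" using d0 2 by simp
        then obtain c' where "c' \<in> L" and c': "c - d / t < c'"
          unfolding c_def using less_cSup_iff[OF _ bdd] \<open>- B \<in> L\<close> by blast
        then obtain u' where u': "u' \<in> M" "\<forall>\<omega>\<in>\<Omega>. c' \<le> f \<omega> + u' \<omega>"
          by (auto simp: L_def)
        have "d - t * (c - c') \<le> 0"
        proof (rule gamble_space_le_0[OF M gamble_space_comb[OF M u u'(1), of 1 t]])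
          fix \<omega> assume \<omega>: "\<omega> \<in> \<Omega>"
          then have "t * c' \<le> t * (f \<omega> + u' \<omega>)"
            using u'(2) 2 by (intro mult_left_mono) auto
          then show "d - t * (c - c') \<le> 1 * u \<omega> + t * u' \<omega>"
            using d[rule_format, OF \<omega>] unfolding v by (simp add: algebra_simps)
        qed
        moreover have "t * (c - c') < d"
          using c' 2 by (simp add: field_simps)
        ultimately show False by simp
      next
        case 3
        \<comment> \<open>For negative \<open>t\<close>, dividing the bound by \<open>- t\<close>
          makes a multiple of \<open>u\<close> a witness for an element of \<open>L\<close> above
          its supremum.\<close>
        have "c + d / (- t) \<in> L"
          unfolding L_def
        proof (intro CollectI bexI ballI)
          show "(\<lambda>\<omega>. (1 / (- t)) * u \<omega> + 0 * u \<omega>) \<in> M"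
            by (rule gamble_space_comb[OF M u u])
          fix \<omega> assume "\<omega> \<in> \<Omega>"
          then have "d / (- t) \<le> (u \<omega> + t * (c - f \<omega>)) / (- t)"
            using d 3 unfolding v by (intro divide_right_mono) auto
          also have "\<dots> = (1 / (- t)) * u \<omega> - (c - f \<omega>)"
            using 3 by (simp add: field_simps)
          finally show "c + d / (- t) \<le> f \<omega> + ((1 / (- t)) * u \<omega> + 0 * u \<omega>)"
            by simp
        qed
        then have "c + d / (- t) \<le> c"
          unfolding c_def by (rule cSup_upper[OF _ bdd])
        moreover have "d / (- t) > 0" using 3 d0 by (simp add: divide_less_0_iff)
        ultimately show False by linarith
      qed
    qed
  qed
  moreover have "M \<subseteq> V"
  proof
    fix u assume "u \<in> M"
    from V[OF this, of 0] show "u \<in> V" by simp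
  qed
  ultimately have "V = M" by (rule max)
  moreover have "(\<lambda>\<omega>. c - f \<omega>) \<in> V"
    using V[OF gamble_space_zero[OF M], of 1] by simp
  ultimately show ?thesis by blast
qed

text \<open>The prices of indicators in a maximal extension of \<open>W\<close> form the measure. By
  linearity the price of a simple function is its simple integral, and uniform approximation extends
  this to each \<open>f\<close> priced in \<open>W\<close>.\<close>

lemma gamble_space_represented:
  assumes sa: "sigma_algebra \<Omega> F" and W: "gamble_space \<Omega> W"
  shows "\<exists>p\<in>fin_add_prob \<Omega> F. \<forall>f c. f \<in> borel_measurable (sigma \<Omega> F) \<longrightarrow> bounded (f ` \<Omega>)
    \<longrightarrow> (\<lambda>\<omega>. c - f \<omega>) \<in> W \<longrightarrow> fa_integral \<Omega> F p f = c"
proof -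
  interpret sigma_algebra \<Omega> F by fact
  obtain M where M: "gamble_space \<Omega> M" and "W \<subseteq> M"
    and max: "\<And>V. gamble_space \<Omega> V \<Longrightarrow> M \<subseteq> V \<Longrightarrow> V = M"
    using maximal_gamble_space[OF W] by blast
  note comb = gamble_space_comb[OF M] and le_0 = gamble_space_le_0[OF M]
  have "\<exists>c. (\<lambda>\<omega>. c - indicator A \<omega>) \<in> M" for A
    by (rule maximal_gamble_space_price[OF M max])
       (auto simp: bounded_iff indicator_def intro!: exI[of _ 1])
  then obtain p where p: "(\<lambda>\<omega>. p A - indicator A \<omega>) \<in> M" for A
    by metis
  \<comment> \<open>All three properties of \<open>p\<close> come from the lower-bound clause. A
    gamble of \<open>M\<close> that is constant on \<open>\<Omega>\<close> must vanish, as the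
    clause applies to it and to its negative; this gives the total mass and additivity.\<close>
  have "0 \<le> p A" for A
    using le_0[OF comb[OF p[of A] p[of A], of "- 1" 0], of "- p A"] by simp
  moreover have "p \<Omega> = 1"
    using le_0[OF comb[OF p[of \<Omega>] p[of \<Omega>], of "1" 0], of "p \<Omega> - 1"]
      le_0[OF comb[OF p[of \<Omega>] p[of \<Omega>], of "- 1" 0], of "1 - p \<Omega>"] by simp
  moreover have "p (A \<union> B) = p A + p B" if "A \<inter> B = {}" for A B
  proof -
    have ind: "indicator (A \<union> B) \<omega> = indicator A \<omega> + (indicator B \<omega> :: real)" for \<omega>
      using that by (auto simp: indicator_def)
    note u = comb[OF p[of "A \<union> B"] comb[OF p[of A] p[of B], of 1 1]]
    show ?thesis
      using le_0[OF u, of "p (A \<union> B) - (p A + p B)" 1 "- 1"]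
        le_0[OF u, of "p A + p B - p (A \<union> B)" "- 1" 1] by (simp add: ind)
  qed
  ultimately have prob: "p \<in> fin_add_prob \<Omega> F"
    by (simp add: fin_add_prob_def additive_def)
  moreover have "fa_integral \<Omega> F p f = c"
    if f: "f \<in> borel_measurable (sigma \<Omega> F)" and bd: "bounded (f ` \<Omega>)"
      and "(\<lambda>\<omega>. c - f \<omega>) \<in> W" for f c
  proof -
    have c: "(\<lambda>\<omega>. c - f \<omega>) \<in> M" using that \<open>W \<subseteq> M\<close> by blast
    have close: "\<bar>fa_integral \<Omega> F p f - c\<bar> \<le> \<delta>" if "\<delta> > 0" for \<delta>
    proof -
      from bounded_measurable_approx_simple[OF f _ that] bd obtain g
        where g: "simple_function (sigma \<Omega> F) g" and le: "\<And>\<omega>. g \<omega> \<le> f \<omega>" "\<And>\<omega>. f \<omega> \<le> g \<omega> + \<delta>"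
        by (metis space_measure_of_conv)
      let ?I = "fa_simple_integral \<Omega> p g"
      \<comment> \<open>Pricing every level set of \<open>g\<close> separately puts into
        \<open>M\<close> a gamble that equals \<open>?I - g\<close> on \<open>\<Omega>\<close>.
        Comparing it with \<open>c - f\<close> in both directions places \<open>?I\<close> between
        \<open>c - \<delta>\<close> and \<open>c\<close>.\<close>
      let ?u = "\<lambda>\<omega>. \<Sum>x\<in>g ` \<Omega>. x * (p (g -` {x} \<inter> \<Omega>) - indicator (g -` {x} \<inter> \<Omega>) \<omega>)"
      have fin: "finite (g ` \<Omega>)"
        using g by (simp add: simple_function_def space_measure_of_conv)
      have u: "?u \<in> M"
        by (rule gamble_space_sum[OF M fin p])
      have u_eq: "?u \<omega> = ?I - g \<omega>" if "\<omega> \<in> \<Omega>" for \<omega>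
      proof -
        have "(\<Sum>x\<in>g ` \<Omega>. x * indicator (g -` {x} \<inter> \<Omega>) \<omega>) = (\<Sum>x\<in>g ` \<Omega>. if x = g \<omega> then x else 0)"
          using that by (intro sum.cong) auto
        also have "\<dots> = g \<omega>"
          using fin that by simp
        finally show ?thesis
          by (simp add: fa_simple_integral_def right_diff_distrib sum_subtractf)
      qed
      have "?I - c \<le> 0"
      proof (rule le_0[OF comb[OF u c, of 1 "- 1"]])
        fix \<omega> assume "\<omega> \<in> \<Omega>"
        then show "?I - c \<le> 1 * ?u \<omega> + - 1 * (c - f \<omega>)"
          using le(1)[of \<omega>] by (simp only: u_eq) simp
      qed
      moreover have "c - ?I - \<delta> \<le> 0"
      proof (rule le_0[OF comb[OF u c, of "- 1" 1]])
        fix \<omega> assume "\<omega> \<in> \<Omega>"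
        then show "c - ?I - \<delta> \<le> - 1 * ?u \<omega> + 1 * (c - f \<omega>)"
          using le(2)[of \<omega>] by (simp only: u_eq) simp
      qed
      ultimately show ?thesis
        using fa_integral_between[OF sa prob g le] by linarith
    qed
    have "\<bar>fa_integral \<Omega> F p f - c\<bar> \<le> 0"
      by (rule field_le_epsilon) (use close in simp)
    then show ?thesis by simp
  qed
  ultimately show ?thesis by blast
qed

section \<open>Coherent previsions and gamble spaces\<close>

text \<open>Indexing combinations by finite subsets of \<open>H\<close> makes closure simple: take
  the union of the two index sets and add the coefficients, extended by 0.\<close>

lemma coherent_gamble_space:
  assumes coh: "coherent \<Omega> H \<pi>"
  shows "gamble_space \<Omega> {u. \<exists>J \<beta>. finite J \<and> J \<subseteq> H \<and> u = (\<lambda>\<omega>. \<Sum>h\<in>J. \<beta> h * (\<pi> h - h \<omega>))}"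
    (is "gamble_space \<Omega> ?W")
  unfolding gamble_space_def
proof (intro conjI ballI allI impI)
  show "(\<lambda>_. 0) \<in> ?W"
    by (intro CollectI exI[of _ "{}"]) simp
next
  fix u v a b assume "u \<in> ?W" "v \<in> ?W"
  then obtain J \<beta> K \<gamma> where J: "finite J" "J \<subseteq> H" "u = (\<lambda>\<omega>. \<Sum>h\<in>J. \<beta> h * (\<pi> h - h \<omega>))"
    and K: "finite K" "K \<subseteq> H" "v = (\<lambda>\<omega>. \<Sum>h\<in>K. \<gamma> h * (\<pi> h - h \<omega>))"
    by blast
  define \<alpha> where "\<alpha> h = a * (if h \<in> J then \<beta> h else 0) + b * (if h \<in> K then \<gamma> h else 0)" for h
  have "a * u \<omega> + b * v \<omega> = (\<Sum>h\<in>J \<union> K. \<alpha> h * (\<pi> h - h \<omega>))" for \<omega>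
  proof -
    have "u \<omega> = (\<Sum>h\<in>J \<union> K. (if h \<in> J then \<beta> h else 0) * (\<pi> h - h \<omega>))"
      unfolding J(3) using J(1) K(1) by (intro sum.mono_neutral_cong_left) auto
    moreover have "v \<omega> = (\<Sum>h\<in>J \<union> K. (if h \<in> K then \<gamma> h else 0) * (\<pi> h - h \<omega>))"
      unfolding K(3) using J(1) K(1) by (intro sum.mono_neutral_cong_left) auto
    ultimately show ?thesis
      by (simp only: sum_distrib_left sum.distrib[symmetric] \<alpha>_def distrib_right mult.assoc)
  qed
  then show "(\<lambda>\<omega>. a * u \<omega> + b * v \<omega>) \<in> ?W"
    using J(1,2) K(1,2) by (intro CollectI exI[of _ "J \<union> K"] exI[of _ \<alpha>]) auto
next
  fix u d assume "u \<in> ?W" and d: "\<forall>\<omega>\<in>\<Omega>. d \<le> u \<omega>"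
  then obtain J \<beta> where J: "finite J" "J \<subseteq> H" "u = (\<lambda>\<omega>. \<Sum>h\<in>J. \<beta> h * (\<pi> h - h \<omega>))"
    by blast
  \<comment> \<open>Enumerating \<open>J\<close> from 1 returns to the indexed sums of the
    definition of coherence.\<close>
  obtain k where k: "bij_betw k {1..card J} J"
    using ex_bij_betw_nat_finite_1[OF J(1)] by blast
  have "(\<Sum>i=1..card J. \<beta> (k i) * (\<pi> (k i) - k i \<omega>)) = u \<omega>" for \<omega>
    unfolding J(3) by (rule sum.reindex_bij_betw[OF k])
  moreover have "\<forall>i\<in>{1..card J}. k i \<in> H"
    using k J(2) by (auto simp: bij_betw_def)
  then have "(INF \<omega>\<in>\<Omega>. ereal (\<Sum>i=1..card J. \<beta> (k i) * (\<pi> (k i) - k i \<omega>))) \<le> 0"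
    using coh[unfolded coherent_def, rule_format, of "card J" k "\<lambda>i. \<beta> (k i)"] by blast
  moreover have "ereal d \<le> (INF \<omega>\<in>\<Omega>. ereal (u \<omega>))"
    using d by (intro INF_greatest) simp
  ultimately have "ereal d \<le> 0"
    by (simp only:)
  then show "d \<le> 0" by (simp add: zero_ereal_def)
qed

lemma representable_imp_coherent:
  assumes sa: "sigma_algebra \<Omega> F" and H: "H \<subseteq> Linfty \<Omega> F" and p: "p \<in> fin_add_prob \<Omega> F"
    and rep: "\<And>h. h \<in> H \<Longrightarrow> fa_integral \<Omega> F p h = \<pi> h"
  shows "coherent \<Omega> H \<pi>"
  unfolding coherent_def
proof (intro allI impI)
  fix n :: nat and f :: "nat \<Rightarrow> 'a \<Rightarrow> real" and \<beta> :: "nat \<Rightarrow> real"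
  assume f: "\<forall>i\<in>{1..n}. f i \<in> H"
  let ?u = "\<lambda>\<omega>. \<Sum>i=1..n. \<beta> i * (\<pi> (f i) - f i \<omega>)"
  show "(INF \<omega>\<in>\<Omega>. ereal (?u \<omega>)) \<le> 0"
  proof (rule ccontr)
    assume "\<not> (INF \<omega>\<in>\<Omega>. ereal (?u \<omega>)) \<le> 0"
    \<comment> \<open>A real number strictly between 0 and the infimum exists also when the infimum
      is infinite.\<close>
    then obtain d where d: "0 < ereal d" "ereal d < (INF \<omega>\<in>\<Omega>. ereal (?u \<omega>))"
      using ereal_dense2[of 0] by (auto simp: not_le)
    have "d \<le> 0"
    proof (rule fa_integral_coherent[OF sa p])
      show "f i \<in> borel_measurable (sigma \<Omega> F)" "bounded (f i ` \<Omega>)" if "i \<in> {1..n}" for i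
        using f H that by (auto simp: Linfty_def)
      fix \<omega> assume \<omega>: "\<omega> \<in> \<Omega>"
      have "ereal d \<le> ereal (?u \<omega>)"
        using d(2) INF_lower[OF \<omega>, of "\<lambda>\<omega>. ereal (?u \<omega>)"] by order
      then show "d \<le> (\<Sum>i=1..n. \<beta> i * (fa_integral \<Omega> F p (f i) - f i \<omega>))"
        using rep f by simp
    qed simp
    then show False using d(1) by simp
  qed
qed

subsection \<open>Countable additivity\<close>

text \<open>Otherwise every \<open>A k\<close> is null for the measure induced by \<open>p\<close>,
  hence so is their union \<open>\<Omega>\<close>, although \<open>p \<Omega> = 1\<close>.\<close>

lemma countably_additive_ex_pos:
  assumes sa: "sigma_algebra \<Omega> F" and p: "p \<in> fin_add_prob \<Omega> F"
    and ca: "countably_additive F (\<lambda>A. ennreal (p A))"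
    and A: "\<And>k::nat. A k \<in> F" "\<Omega> = (\<Union>k. A k)"
  shows "\<exists>k. 0 < p (A k)"
proof (rule ccontr)
  interpret sigma_algebra \<Omega> F by fact
  assume "\<not> (\<exists>k. 0 < p (A k))"
  then have *: "ennreal (p (A k)) = 0" for k
    by (simp add: ennreal_eq_0_iff not_less)
  \<comment> \<open>The union over the empty index set yields \<open>p {} = 0\<close>.\<close>
  have pos: "positive F (\<lambda>A. ennreal (p A))"
    using fin_add_prob_UN[OF sa p, of "{} :: nat set" A]
    by (simp add: positive_def disjoint_family_on_def)
  have ms: "measure_space \<Omega> F (\<lambda>A. ennreal (p A))"
    using sa pos ca by (simp add: measure_space_def)
  define N where "N = measure_of \<Omega> F (\<lambda>A. ennreal (p A))"
  have em: "emeasure N B = ennreal (p B)" if "B \<in> F" for B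
    unfolding N_def using ms that by (intro emeasure_measure_of_sigma) (auto simp: measure_space_def)
  have "(\<Union>k. A k) \<in> null_sets N"
    using A(1) em * by (intro null_sets_UN) (auto simp: null_sets_def N_def)
  then have "emeasure N \<Omega> = 0"
    using A(2) by auto
  then show False
    using em[of \<Omega>] p by (simp add: fin_add_prob_def)
qed

text \<open>Once some \<open>A k\<close> has positive measure, adding a small multiple of
  \<open>p (A k) - indicator (A k)\<close> to the positive gamble gives one bounded below by a
  positive constant, against coherence of the integral.\<close>

lemma countably_additive_no_pos_gamble:
  fixes f :: "nat \<Rightarrow> 'a \<Rightarrow> real"
  assumes sa: "sigma_algebra \<Omega> F" and p: "p \<in> fin_add_prob \<Omega> F"
    and f: "\<And>i. i \<in> {1..n} \<Longrightarrow> f i \<in> borel_measurable (sigma \<Omega> F)"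
    and bd: "\<And>i. i \<in> {1..n} \<Longrightarrow> bounded (f i ` \<Omega>)"
    and pos: "\<And>\<omega>. \<omega> \<in> \<Omega> \<Longrightarrow> 0 < (\<Sum>i=1..n. \<beta> i * (fa_integral \<Omega> F p (f i) - f i \<omega>))"
  shows "\<not> countably_additive F (\<lambda>A. ennreal (p A))"
proof
  interpret sigma_algebra \<Omega> F by fact
  assume ca: "countably_additive F (\<lambda>A. ennreal (p A))"
  let ?E = "fa_integral \<Omega> F p"
  let ?u = "\<lambda>\<omega>. \<Sum>i=1..n. \<beta> i * (?E (f i) - f i \<omega>)"
  define A where "A k = {\<omega>\<in>\<Omega>. 1 / real (Suc k) < ?u \<omega>}" for k
  have "?u \<in> borel_measurable (sigma \<Omega> F)"
    using f by (intro borel_measurable_sum borel_measurable_times borel_measurable_diff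
        borel_measurable_const) auto
  then have "{\<omega>\<in>space (sigma \<Omega> F). 1 / real (Suc k) < ?u \<omega>} \<in> sets (sigma \<Omega> F)" for k
    by measurable
  then have A: "A k \<in> F" for k
    by (simp add: A_def space_measure_of_conv)
  have "\<Omega> = (\<Union>k. A k)"
  proof
    show "\<Omega> \<subseteq> (\<Union>k. A k)"
    proof
      fix \<omega> assume "\<omega> \<in> \<Omega>"
      with nat_approx_posE[OF pos[OF this]] show "\<omega> \<in> (\<Union>k. A k)"
        unfolding A_def by blast
    qed
  qed (auto simp: A_def)
  from countably_additive_ex_pos[OF sa p ca A this] obtain k where k: "0 < p (A k)"
    by (rule exE)
  let ?r = "1 / real (Suc k)"
  \<comment> \<open>Index 0 is free, since the given family starts at 1; it carries the
    indicator.\<close>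
  let ?g = "\<lambda>i. if i = 0 then indicator (A k) else f i"
  let ?\<gamma> = "\<lambda>i. if i = 0 then ?r else \<beta> i"
  have "?r * p (A k) \<le> 0"
  proof (rule fa_integral_coherent[OF sa p, where J = "{0..n}" and f = ?g and \<beta> = ?\<gamma>])
    fix i assume i: "i \<in> {0..n}"
    have "(indicator (A k) :: 'a \<Rightarrow> real) \<in> borel_measurable (sigma \<Omega> F)"
      using A[of k] by (intro borel_measurable_indicator) simp
    then show "?g i \<in> borel_measurable (sigma \<Omega> F)"
      using f[of i] i by (cases "i = 0") auto
    have "bounded ((indicator (A k) :: 'a \<Rightarrow> real) ` \<Omega>)"
      by (auto simp: bounded_iff indicator_def intro!: exI[of _ 1])
    then show "bounded (?g i ` \<Omega>)"
      using bd[of i] i by (cases "i = 0") auto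
  next
    fix \<omega> assume \<omega>: "\<omega> \<in> \<Omega>"
    have "(\<Sum>i\<in>{0..n}. ?\<gamma> i * (?E (?g i) - ?g i \<omega>))
        = ?r * (p (A k) - indicator (A k) \<omega>) + ?u \<omega>"
      using A by (simp add: sum.atLeast_Suc_atMost fa_integral_indicator[OF sa p])
    \<comment> \<open>On \<open>A k\<close> the gamble exceeds \<open>?r\<close> by definition;
      elsewhere it is still positive.\<close>
    moreover have "?r * indicator (A k) \<omega> \<le> ?u \<omega>"
      using pos[OF \<omega>] by (auto simp: A_def indicator_def)
    ultimately show "?r * p (A k) \<le> (\<Sum>i\<in>{0..n}. ?\<gamma> i * (?E (?g i) - ?g i \<omega>))"
      by (simp add: right_diff_distrib)
  qed simp
  moreover have "0 < ?r * p (A k)"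
    using k by simp
  ultimately show False by linarith
qed

theorem theorem3p4:
  fixes \<Omega> :: "'a set" and F :: "'a set set"
    and H :: "('a \<Rightarrow> real) set" and \<pi> :: "('a \<Rightarrow> real) \<Rightarrow> real"
  assumes "sigma_algebra \<Omega> F"
    and "H \<subseteq> Linfty \<Omega> F"
    and "restrict (indicator \<Omega>) \<Omega> \<in> H"
  shows "(coherent \<Omega> H \<pi> \<longleftrightarrow>
            (\<exists>p\<in>fin_add_prob \<Omega> F. \<forall>h\<in>H. fa_integral \<Omega> F p h = \<pi> h))
       \<and> (coherent \<Omega> H \<pi> \<longrightarrow>
            (\<exists>(n::nat) (f :: nat \<Rightarrow> 'a \<Rightarrow> real) (\<beta> :: nat \<Rightarrow> real).
               (\<forall>i\<in>{1..n}. f i \<in> H) \<and>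
               (\<forall>\<omega>\<in>\<Omega>. (\<Sum>i=1..n. \<beta> i * (\<pi> (f i) - f i \<omega>)) > 0)) \<longrightarrow>
            (\<forall>p\<in>fin_add_prob \<Omega> F. (\<forall>h\<in>H. fa_integral \<Omega> F p h = \<pi> h) \<longrightarrow>
               \<not> countably_additive F (\<lambda>A. ennreal (p A))))"
proof (intro conjI impI ballI)
  have H: "h \<in> borel_measurable (sigma \<Omega> F)" "bounded (h ` \<Omega>)" if "h \<in> H" for h
    using assms(2) that by (auto simp: Linfty_def)
  show "coherent \<Omega> H \<pi> \<longleftrightarrow>
      (\<exists>p\<in>fin_add_prob \<Omega> F. \<forall>h\<in>H. fa_integral \<Omega> F p h = \<pi> h)"
  proof
    assume coh: "coherent \<Omega> H \<pi>"
    \<comment> \<open>A singleton index set with coefficient 1, so the representing measure must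
      price \<open>h\<close> at \<open>\<pi> h\<close>.\<close>
    have "(\<lambda>\<omega>. \<pi> h - h \<omega>) \<in> {u. \<exists>J \<beta>. finite J \<and> J \<subseteq> H \<and> u = (\<lambda>\<omega>. \<Sum>h\<in>J. \<beta> h * (\<pi> h - h \<omega>))}"
      if "h \<in> H" for h
      using that by (intro CollectI exI[of _ "{h}"] exI[of _ "\<lambda>_. 1"]) simp
    then show "\<exists>p\<in>fin_add_prob \<Omega> F. \<forall>h\<in>H. fa_integral \<Omega> F p h = \<pi> h"
      using gamble_space_represented[OF assms(1) coherent_gamble_space[OF coh]] H by meson
  next
    assume "\<exists>p\<in>fin_add_prob \<Omega> F. \<forall>h\<in>H. fa_integral \<Omega> F p h = \<pi> h"
    then show "coherent \<Omega> H \<pi>"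
      using representable_imp_coherent[OF assms(1,2)] by blast
  qed
  fix p
  assume p: "p \<in> fin_add_prob \<Omega> F" and rep: "\<forall>h\<in>H. fa_integral \<Omega> F p h = \<pi> h"
    and "\<exists>(n::nat) f \<beta>. (\<forall>i\<in>{1..n}. f i \<in> H) \<and>
      (\<forall>\<omega>\<in>\<Omega>. (\<Sum>i=1..n. \<beta> i * (\<pi> (f i) - f i \<omega>)) > 0)"
  then obtain n :: nat and f \<beta> where f: "\<And>i. i \<in> {1..n} \<Longrightarrow> f i \<in> H"
    and pos: "\<And>\<omega>. \<omega> \<in> \<Omega> \<Longrightarrow> (\<Sum>i=1..n. \<beta> i * (\<pi> (f i) - f i \<omega>)) > 0"
    by blast
  \<comment> \<open>As \<open>p\<close> represents \<pi>, the positive gamble is one whose prices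
    are integrals with respect to \<open>p\<close>.\<close>
  show "\<not> countably_additive F (\<lambda>A. ennreal (p A))"
  proof (rule countably_additive_no_pos_gamble[OF assms(1) p H(1)[OF f] H(2)[OF f]])
    fix \<omega> assume "\<omega> \<in> \<Omega>"
    then show "0 < (\<Sum>i=1..n. \<beta> i * (fa_integral \<Omega> F p (f i) - f i \<omega>))"
      using pos[of \<omega>] rep f by simp
  qed
qed

end
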